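(* Let $T\in\mathbb{F}^{n}\otimes\mathbb{F}^{n}\otimes\mathbb{F}^{n}$ be a concise tensor that is pivot-matched. Then $\lim_{m\to\infty} Q(T^{\boxtimes m})^{1/m}\geq\sqrt{n}$.
   Context: $\mathbb{F}$ is any field. $T$ is concise if each of its three flattenings has rank $n$. The subrank $Q(T)$ is the largest $r$ with linear maps $L_i$ such that $(L_1\otimes L_2\otimes L_3)T=\sum_{i=1}^r e_i\otimes e_i\otimes e_i$; $\boxtimes$ is the Kronecker product, and $\lim_{m\to\infty} Q(T^{\boxtimes m})^{1/m}$ is the asymptotic subrank. The pivot $p(A)=(f(A),g(A))$ of a nonzero matrix $A$ is the lexicographically smallest index $(i,j)$ with $A_{i,j}\neq 0$; for matrices $A_1,\dots,A_n$ the pivot map is $\ell\mapsto p(A_\ell)$. $T$ is pivot-matched if there are tensors $T_A,T_B$ isomorphic (equivalent) to $T$ such that, with $A_i=\sum_{j,k}(T_A)_{i,j,k}e_j\otimes e_k$ ($i\in[n]$) the 1-slices of $T_A$ with pivot map $p_A=(f_A,g_A)$, and $B_k=\sum_{i,j}(T_B)_{i,j,k}e_i\otimes e_j$ ($k\in[n]$) the 3-slices of $T_B$ with pivot map $p_B=(f_B,g_B)$, both $p_A$ and $p_B$ are injective and $f_A(\ell)=f_B(\ell)$ for all $\ell\in[n]$. *)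

theory Defs
  imports Complex_Main "Jordan_Normal_Form.DL_Rank"
begin

text \<open>
  A tensor in \<open>F^n1 \<otimes> F^n2 \<otimes> F^n3\<close> is given by its coordinate function. The format is carried
  separately; indices run from 0, and entries outside the format are never inspected.
\<close>
type_synonym 'a tensor3 = "nat \<Rightarrow> nat \<Rightarrow> nat \<Rightarrow> 'a"

text \<open>\<open>(L1 \<otimes> L2 \<otimes> L3) T\<close>, for a tensor of format (dim_col L1, dim_col L2, dim_col L3).\<close>
definition tensor_map :: "'a::field mat \<Rightarrow> 'a mat \<Rightarrow> 'a mat \<Rightarrow> 'a tensor3 \<Rightarrow> 'a tensor3" where
  "tensor_map L1 L2 L3 T = (\<lambda>a b c.
     \<Sum>i<dim_col L1. \<Sum>j<dim_col L2. \<Sum>k<dim_col L3.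
       L1 $$ (a, i) * L2 $$ (b, j) * L3 $$ (c, k) * T i j k)"

definition tensor_eq :: "nat \<Rightarrow> 'a tensor3 \<Rightarrow> 'a tensor3 \<Rightarrow> bool" where
  "tensor_eq n S T \<longleftrightarrow> (\<forall>i<n. \<forall>j<n. \<forall>k<n. S i j k = T i j k)"

definition unit_tensor :: "'a::field tensor3" where
  "unit_tensor = (\<lambda>i j k. if i = j \<and> j = k then 1 else 0)"

definition isomorphic_tensors :: "nat \<Rightarrow> 'a::field tensor3 \<Rightarrow> 'a tensor3 \<Rightarrow> bool" where
  "isomorphic_tensors n S T \<longleftrightarrow>
     (\<exists>L1 \<in> carrier_mat n n. \<exists>L2 \<in> carrier_mat n n. \<exists>L3 \<in> carrier_mat n n.
        invertible_mat L1 \<and> invertible_mat L2 \<and> invertible_mat L3 \<and>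
        tensor_eq n T (tensor_map L1 L2 L3 S))"

text \<open>A pair of indices below n is encoded as the column index \<open>p\<close> with digits \<open>p div n\<close>, \<open>p mod n\<close>.\<close>
definition flattening1 :: "nat \<Rightarrow> 'a tensor3 \<Rightarrow> 'a mat" where
  "flattening1 n T = mat n (n * n) (\<lambda>(i, p). T i (p div n) (p mod n))"

definition flattening2 :: "nat \<Rightarrow> 'a tensor3 \<Rightarrow> 'a mat" where
  "flattening2 n T = mat n (n * n) (\<lambda>(j, p). T (p div n) j (p mod n))"

definition flattening3 :: "nat \<Rightarrow> 'a tensor3 \<Rightarrow> 'a mat" where
  "flattening3 n T = mat n (n * n) (\<lambda>(k, p). T (p div n) (p mod n) k)"

definition concise :: "nat \<Rightarrow> 'a::field tensor3 \<Rightarrow> bool" where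
  "concise n T \<longleftrightarrow>
     vec_space.rank n (flattening1 n T) = n \<and>
     vec_space.rank n (flattening2 n T) = n \<and>
     vec_space.rank n (flattening3 n T) = n"

text \<open>
  The defining set contains 0 and is bounded by n (compare ranks of flattenings), so the greatest
  element exists.
\<close>
definition subrank :: "nat \<Rightarrow> 'a::field tensor3 \<Rightarrow> nat" where
  "subrank n T = (GREATEST r.
     \<exists>L1 \<in> carrier_mat r n. \<exists>L2 \<in> carrier_mat r n. \<exists>L3 \<in> carrier_mat r n.
       tensor_eq r (tensor_map L1 L2 L3 T) unit_tensor)"

text \<open>
  Here \<open>n\<close> is the size of the second factor: in each direction the index pair \<open>(a, b)\<close> with
  \<open>b < n\<close> is encoded as \<open>a * n + b\<close>.
\<close>
definition kronecker :: "nat \<Rightarrow> 'a::field tensor3 \<Rightarrow> 'a tensor3 \<Rightarrow> 'a tensor3" where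
  "kronecker n S T = (\<lambda>i j k. S (i div n) (j div n) (k div n) * T (i mod n) (j mod n) (k mod n))"

text \<open>The \<open>m\<close>-th Kronecker power of an \<open>n \<times> n \<times> n\<close> tensor has format \<open>n^m\<close> in each direction.\<close>
primrec kronecker_power :: "nat \<Rightarrow> 'a::field tensor3 \<Rightarrow> nat \<Rightarrow> 'a tensor3" where
  "kronecker_power n T 0 = (\<lambda>i j k. 1)"
| "kronecker_power n T (Suc m) = kronecker n (kronecker_power n T m) T"

definition nonzero_entries :: "'a::zero mat \<Rightarrow> (nat \<times> nat) set" where
  "nonzero_entries A = {(i, j). i < dim_row A \<and> j < dim_col A \<and> A $$ (i, j) \<noteq> 0}"

text \<open>Only meaningful for a nonzero matrix.\<close>
definition pivot :: "'a::zero mat \<Rightarrow> nat \<times> nat" where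
  "pivot A = (THE p. p \<in> nonzero_entries A \<and>
     (\<forall>q \<in> nonzero_entries A. q \<noteq> p \<longrightarrow> (p, q) \<in> less_than <*lex*> less_than))"

definition slice1 :: "nat \<Rightarrow> 'a tensor3 \<Rightarrow> nat \<Rightarrow> 'a mat" where
  "slice1 n T i = mat n n (\<lambda>(j, k). T i j k)"

definition slice3 :: "nat \<Rightarrow> 'a tensor3 \<Rightarrow> nat \<Rightarrow> 'a mat" where
  "slice3 n T k = mat n n (\<lambda>(i, j). T i j k)"

text \<open>
  The slices are required to be nonzero so that the pivot maps are defined; for concise \<open>T\<close>
  this holds automatically.
\<close>
definition pivot_matched :: "nat \<Rightarrow> 'a::field tensor3 \<Rightarrow> bool" where
  "pivot_matched n T \<longleftrightarrow>
     (\<exists>TA TB. isomorphic_tensors n T TA \<and> isomorphic_tensors n T TB \<and>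
        (\<forall>l<n. slice1 n TA l \<noteq> 0\<^sub>m n n \<and> slice3 n TB l \<noteq> 0\<^sub>m n n) \<and>
        inj_on (\<lambda>l. pivot (slice1 n TA l)) {..<n} \<and>
        inj_on (\<lambda>l. pivot (slice3 n TB l)) {..<n} \<and>
        (\<forall>l<n. fst (pivot (slice1 n TA l)) = fst (pivot (slice3 n TB l))))"

end

theory Submission
  imports Defs
begin

text \<open>
  Scaling the coordinates of \<open>T_A\<close> by weights degenerates it to its pivot tensor
  \<open>\<Sum>l. e_l \<otimes> e_(f l) \<otimes> e_(g l)\<close>, and \<open>T_B\<close> likewise to \<open>\<Sum>l. e_(f l) \<otimes> e_(h l) \<otimes> e_l\<close>.
  In the product of the two pivot tensors, the coordinates \<open>(l, f l)\<close>, \<open>(f l, h l)\<close> and \<open>(g l, l)\<close>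
  in the three directions cut out exactly a diagonal of size \<open>n\<close>, because both pivot maps are
  injective and share \<open>f\<close>. So \<open>T \<boxtimes> T\<close> restricts to an \<open>n \<times> n \<times> n\<close> tensor whose support has
  nonnegative weight, with weight 0 exactly on the diagonal. In its \<open>m\<close>-th power, fixing the weights
  in the three directions isolates a part of the diagonal; there are only polynomially many
  weight classes, so one of them has at least \<open>n^m / poly m\<close> elements. This works over every field,
  without interpolation.
\<close>

section \<open>Restriction of tensors\<close>

text \<open>The restriction preorder on tensors. For \<open>S = unit_tensor\<close> it is the
  predicate maximised in \<open>subrank\<close>.\<close>

definition restricts_to :: "nat \<Rightarrow> 'a::field tensor3 \<Rightarrow> nat \<Rightarrow> 'a tensor3 \<Rightarrow> bool" where
  "restricts_to n T r S \<longleftrightarrow>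
     (\<exists>L1 \<in> carrier_mat r n. \<exists>L2 \<in> carrier_mat r n. \<exists>L3 \<in> carrier_mat r n.
        tensor_eq r (tensor_map L1 L2 L3 T) S)"

lemma restricts_to_iff:
  "restricts_to n T r S \<longleftrightarrow> (\<exists>A B C. \<forall>a<r. \<forall>b<r. \<forall>c<r.
     S a b c = (\<Sum>i<n. \<Sum>j<n. \<Sum>k<n. A a i * B b j * C c k * T i j k))"
  (is "_ \<longleftrightarrow> ?rhs")
proof
  assume "restricts_to n T r S"
  then obtain L1 L2 L3 where L: "L1 \<in> carrier_mat r n" "L2 \<in> carrier_mat r n" "L3 \<in> carrier_mat r n"
    "tensor_eq r (tensor_map L1 L2 L3 T) S"
    unfolding restricts_to_def by blast
  show ?rhs
    by (rule exI[of _ "\<lambda>a i. L1 $$ (a, i)"], rule exI[of _ "\<lambda>a i. L2 $$ (a, i)"],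
        rule exI[of _ "\<lambda>a i. L3 $$ (a, i)"])
      (use L in \<open>auto simp: tensor_eq_def tensor_map_def\<close>)
next
  assume ?rhs
  then obtain A B C where *: "\<forall>a<r. \<forall>b<r. \<forall>c<r.
     S a b c = (\<Sum>i<n. \<Sum>j<n. \<Sum>k<n. A a i * B b j * C c k * T i j k)" by blast
  show "restricts_to n T r S"
    unfolding restricts_to_def
    by (rule bexI[of _ "mat r n (\<lambda>(a, i). A a i)"], rule bexI[of _ "mat r n (\<lambda>(a, i). B a i)"],
        rule bexI[of _ "mat r n (\<lambda>(a, i). C a i)"])
      (use * in \<open>auto simp: tensor_eq_def tensor_map_def\<close>)
qed

text \<open>Matrices with at most one nonzero entry per row select the coordinates \<open>f\<close>,
  \<open>g\<close>, \<open>h\<close>; the third one also rescales, which later normalises diagonal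
  entries to 1.\<close>

lemma restricts_to_coordinates:
  assumes "\<And>a. a < r \<Longrightarrow> f a < n" "\<And>a. a < r \<Longrightarrow> g a < n" "\<And>a. a < r \<Longrightarrow> h a < n"
    and "\<And>a b c. \<lbrakk>a < r; b < r; c < r\<rbrakk> \<Longrightarrow> S a b c = u c * T (f a) (g b) (h c)"
  shows "restricts_to n T r S"
  unfolding restricts_to_iff
proof (rule exI[of _ "\<lambda>a i. if i = f a then 1 else 0"],
       rule exI[of _ "\<lambda>a i. if i = g a then 1 else 0"],
       rule exI[of _ "\<lambda>a i. if i = h a then u a else 0"], intro allI impI)
  fix a b c assume l: "a < r" "b < r" "c < r"
  have "(\<Sum>i<n. \<Sum>j<n. \<Sum>k<n. (if i = f a then 1 else 0) * (if j = g b then 1 else 0) *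
          (if k = h c then u c else 0) * T i j k)
      = (\<Sum>i<n. \<Sum>j<n. \<Sum>k<n. if k = h c then
           (if j = g b then (if i = f a then u c * T i j k else 0) else 0) else 0)"
    by (intro sum.cong refl) auto
  also have "\<dots> = u c * T (f a) (g b) (h c)"
    using l assms(1-3) by simp
  finally show "S a b c = (\<Sum>i<n. \<Sum>j<n. \<Sum>k<n. (if i = f a then 1 else 0) *
      (if j = g b then 1 else 0) * (if k = h c then u c else 0) * T i j k)"
    using assms(4)[OF l] by simp
qed

lemma sum_product3:
  fixes f g h :: "nat \<Rightarrow> 'a::comm_semiring_0"
  shows "(\<Sum>x\<in>A. \<Sum>y\<in>B. \<Sum>z\<in>C. f x * g y * h z * t) = sum f A * sum g B * sum h C * t"
  by (simp only: sum_distrib_left[symmetric] sum_distrib_right[symmetric])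

lemma restricts_to_trans:
  assumes "restricts_to n T p S" "restricts_to p S r U"
  shows "restricts_to n T r U"
proof -
  obtain A B C where S: "\<And>a b c. \<lbrakk>a < p; b < p; c < p\<rbrakk> \<Longrightarrow>
     S a b c = (\<Sum>i<n. \<Sum>j<n. \<Sum>k<n. A a i * B b j * C c k * T i j k)"
    using assms(1) unfolding restricts_to_iff by blast
  obtain A' B' C' where U: "\<And>a b c. \<lbrakk>a < r; b < r; c < r\<rbrakk> \<Longrightarrow>
     U a b c = (\<Sum>i<p. \<Sum>j<p. \<Sum>k<p. A' a i * B' b j * C' c k * S i j k)"
    using assms(2) unfolding restricts_to_iff by blast
  \<comment> \<open>Indexing by triples reduces the exchange of six nested sums to a single
    \<open>sum.swap\<close>.\<close>
  define P where "P = {..<p} \<times> {..<p} \<times> {..<p}"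
  define N where "N = {..<n} \<times> {..<n} \<times> {..<n}"
  show ?thesis
    unfolding restricts_to_iff
  proof (rule exI[of _ "\<lambda>a i. \<Sum>x<p. A' a x * A x i"],
         rule exI[of _ "\<lambda>a i. \<Sum>x<p. B' a x * B x i"],
         rule exI[of _ "\<lambda>a i. \<Sum>x<p. C' a x * C x i"], intro allI impI)
    fix a b c assume l: "a < r" "b < r" "c < r"
    have "U a b c = (\<Sum>(x, y, z)\<in>P. A' a x * B' b y * C' c z * S x y z)"
      using U[OF l] by (simp add: P_def sum.cartesian_product)
    also have "\<dots> = (\<Sum>(x, y, z)\<in>P. \<Sum>(i, j, k)\<in>N.
        (A' a x * A x i) * (B' b y * B y j) * (C' c z * C z k) * T i j k)"
      by (rule sum.cong)
        (auto simp: P_def N_def S sum.cartesian_product sum_distrib_left case_prod_unfold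
          algebra_simps intro!: sum.cong)
    also have "\<dots> = (\<Sum>(i, j, k)\<in>N. \<Sum>(x, y, z)\<in>P.
        (A' a x * A x i) * (B' b y * B y j) * (C' c z * C z k) * T i j k)"
      by (simp add: case_prod_unfold) (rule sum.swap)
    also have "\<dots> = (\<Sum>(i, j, k)\<in>N. (\<Sum>x<p. A' a x * A x i) * (\<Sum>y<p. B' b y * B y j) *
        (\<Sum>z<p. C' c z * C z k) * T i j k)"
      by (simp only: P_def sum.cartesian_product[symmetric] sum_product3)
    finally show "U a b c = (\<Sum>i<n. \<Sum>j<n. \<Sum>k<n. (\<Sum>x<p. A' a x * A x i) *
        (\<Sum>y<p. B' b y * B y j) * (\<Sum>z<p. C' c z * C z k) * T i j k)"
      by (simp add: N_def sum.cartesian_product)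
  qed
qed

section \<open>Compatibility of restriction with Kronecker products and powers\<close>

lemma sum_div_mod:
  fixes F :: "nat \<Rightarrow> nat \<Rightarrow> 'b::comm_monoid_add"
  shows "(\<Sum>i<m * n. F (i div n) (i mod n)) = (\<Sum>i<m. \<Sum>j<n. F i j)"
proof (induction m)
  case (Suc m)
  have "(\<Sum>i<Suc m * n. F (i div n) (i mod n)) =
      (\<Sum>i<m * n. F (i div n) (i mod n)) + (\<Sum>i\<in>{m * n..<m * n + n}. F (i div n) (i mod n))"
    by (simp add: lessThan_atLeast0 sum.atLeastLessThan_concat add.commute)
  also have "(\<Sum>i\<in>{m * n..<m * n + n}. F (i div n) (i mod n)) = (\<Sum>j<n. F m j)"
    using sum.shift_bounds_nat_ivl[of "\<lambda>i. F (i div n) (i mod n)" 0 "m * n" n]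
    by (simp add: lessThan_atLeast0 add.commute)
  finally show ?case using Suc by simp
qed simp

text \<open>The Kronecker products of the three pairs of maps do it: each summand splits into a
  factor in the \<open>div\<close> digits and one in the \<open>mod\<close> digits, so the sum
  factors.\<close>

lemma restricts_to_kronecker:
  assumes "restricts_to n T r S" "restricts_to n' T' r' S'"
  shows "restricts_to (n * n') (kronecker n' T T') (r * r') (kronecker r' S S')"
proof -
  obtain A B C where S: "\<And>a b c. \<lbrakk>a < r; b < r; c < r\<rbrakk> \<Longrightarrow>
     S a b c = (\<Sum>i<n. \<Sum>j<n. \<Sum>k<n. A a i * B b j * C c k * T i j k)"
    using assms(1) unfolding restricts_to_iff by blast
  obtain A' B' C' where S': "\<And>a b c. \<lbrakk>a < r'; b < r'; c < r'\<rbrakk> \<Longrightarrow>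
     S' a b c = (\<Sum>i<n'. \<Sum>j<n'. \<Sum>k<n'. A' a i * B' b j * C' c k * T' i j k)"
    using assms(2) unfolding restricts_to_iff by blast
  let ?K = "\<lambda>A A' a i. A (a div r') (i div n') * A' (a mod r') (i mod n')"
  show ?thesis
    unfolding restricts_to_iff
  proof (rule exI[of _ "?K A A'"], rule exI[of _ "?K B B'"], rule exI[of _ "?K C C'"],
         intro allI impI)
    fix a b c assume l: "a < r * r'" "b < r * r'" "c < r * r'"
    then have r': "r' > 0" by (cases r') auto
    define X where "X i j k =
      A (a div r') i * B (b div r') j * C (c div r') k * T i j k" for i j k
    define Y where "Y i j k =
      A' (a mod r') i * B' (b mod r') j * C' (c mod r') k * T' i j k" for i j k
    have "(\<Sum>i<n * n'. \<Sum>j<n * n'. \<Sum>k<n * n'.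
        ?K A A' a i * ?K B B' b j * ?K C C' c k * kronecker n' T T' i j k)
      = (\<Sum>i<n * n'. \<Sum>j<n * n'. \<Sum>k<n * n'.
          X (i div n') (j div n') (k div n') * Y (i mod n') (j mod n') (k mod n'))"
      by (intro sum.cong refl) (simp add: X_def Y_def kronecker_def)
    also have "\<dots> = (\<Sum>i<n. \<Sum>i'<n'. \<Sum>j<n. \<Sum>j'<n'. \<Sum>k<n. \<Sum>k'<n'. X i j k * Y i' j' k')"
      by (simp only: sum_div_mod[of "\<lambda>k k'. X _ _ k * Y _ _ k'"]
          sum_div_mod[of "\<lambda>j j'. \<Sum>k<n. \<Sum>k'<n'. X _ j k * Y _ j' k'"]
          sum_div_mod[of "\<lambda>i i'. \<Sum>j<n. \<Sum>j'<n'. \<Sum>k<n. \<Sum>k'<n'. X i j k * Y i' j' k'"])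
    also have "\<dots> = (\<Sum>i<n. \<Sum>j<n. \<Sum>k<n. X i j k) * (\<Sum>i<n'. \<Sum>j<n'. \<Sum>k<n'. Y i j k)"
      by (simp only: sum_product)
    also have "\<dots> = kronecker r' S S' a b c"
      using l r' by (simp add: kronecker_def S S' X_def Y_def less_mult_imp_div_less)
    finally show "kronecker r' S S' a b c = (\<Sum>i<n * n'. \<Sum>j<n * n'. \<Sum>k<n * n'.
        ?K A A' a i * ?K B B' b j * ?K C C' c k * kronecker n' T T' i j k)" by simp
  qed
qed

lemma restricts_to_kronecker_power:
  assumes "restricts_to n T r S"
  shows "restricts_to (n ^ m) (kronecker_power n T m) (r ^ m) (kronecker_power r S m)"
proof (induction m)
  case 0
  show ?case
    by (rule restricts_to_coordinates[of _ id _ id id _ "\<lambda>_. 1"]) auto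
next
  case (Suc m)
  show ?case using restricts_to_kronecker[OF Suc assms] by (simp add: mult.commute)
qed

text \<open>Both sides split an index into the same three mixed-radix digits.\<close>

lemma kronecker_assoc:
  "kronecker n (kronecker m S T) U = kronecker (m * n) S (kronecker n T U)"
proof -
  have 1: "i div (m * n) = i div n div m" for i
    by (metis div_mult2_eq mult.commute)
  have 2: "i mod (m * n) div n = i div n mod m" for i
    by (cases "n = 0") (simp_all add: mult.commute[of m n] mod_mult2_eq)
  have 3: "i mod (m * n) mod n = i mod n" for i
    by (simp add: mod_mod_cancel)
  show ?thesis
    by (simp add: kronecker_def fun_eq_iff 1 2 3 mult.assoc)
qed

lemma kronecker_power_add:
  "kronecker_power n T (m + k) = kronecker (n ^ k) (kronecker_power n T m) (kronecker_power n T k)"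
  by (induction k) (auto simp: kronecker_assoc kronecker_def[of "Suc 0"] mult.commute)

text \<open>The diagonal is found inside the square of \<open>T\<close>, so its powers have to be
  read as even powers of \<open>T\<close>.\<close>

lemma kronecker_power_square:
  "kronecker_power (n * n) (kronecker n T T) m = kronecker_power n T (2 * m)"
  by (induction m) (simp_all add: kronecker_assoc)

section \<open>Subrank\<close>

text \<open>Summing over the second index contracts the unit tensor to the identity matrix of size
  \<open>r\<close>, which then factors through dimension \<open>n\<close>.\<close>

lemma restricts_to_unit_le:
  assumes "restricts_to n T r unit_tensor"
  shows "r \<le> n"
proof (rule ccontr)
  assume "\<not> r \<le> n"
  then have nr: "n < r" by simp
  obtain A B C where u: "\<And>a b c. \<lbrakk>a < r; b < r; c < r\<rbrakk> \<Longrightarrow>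
     unit_tensor a b c = (\<Sum>i<n. \<Sum>j<n. \<Sum>k<n. A a i * B b j * C c k * T i j k)"
    using assms unfolding restricts_to_iff by blast
  define X where "X i c = (\<Sum>b<r. \<Sum>j<n. \<Sum>k<n. B b j * C c k * T i j k)" for i c
  \<comment> \<open>Zero padding makes both factors square, so that a one-sided inverse is
    two-sided.\<close>
  define M where "M = mat r r (\<lambda>(a, i). if i < n then A a i else 0)"
  define N where "N = mat r r (\<lambda>(i, c). if i < n then X i c else 0)"
  have "M * N = 1\<^sub>m r"
  proof (rule eq_matI)
    fix a c assume ac: "a < dim_row (1\<^sub>m r)" "c < dim_col (1\<^sub>m r)"
    then have l: "a < r" "c < r" by auto
    have "(M * N) $$ (a, c) = (\<Sum>i<r. (if i < n then A a i else 0) * (if i < n then X i c else 0))"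
      using l by (simp add: M_def N_def scalar_prod_def lessThan_atLeast0)
    also have "\<dots> = (\<Sum>i<n. A a i * X i c)"
      using nr by (intro sum.mono_neutral_cong_right) auto
    also have "\<dots> = (\<Sum>b<r. \<Sum>i<n. \<Sum>j<n. \<Sum>k<n. A a i * B b j * C c k * T i j k)"
      by (subst sum.swap) (simp add: X_def sum_distrib_left mult.assoc)
    also have "\<dots> = (\<Sum>b<r. unit_tensor a b c)"
      using u l by simp
    also have "\<dots> = (\<Sum>b<r. if b = a then (if a = c then 1 else 0) else 0)"
      by (intro sum.cong) (auto simp: unit_tensor_def)
    also have "\<dots> = 1\<^sub>m r $$ (a, c)" using l by simp
    finally show "(M * N) $$ (a, c) = 1\<^sub>m r $$ (a, c)" .
  qed (auto simp: M_def N_def)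
  then have NM: "N * M = 1\<^sub>m r"
    by (intro mat_mult_left_right_inverse[of M r N]) (auto simp: M_def N_def)
  \<comment> \<open>Row \<open>n\<close> of \<open>N\<close> lies in the padding.\<close>
  have "(N * M) $$ (n, n) = 0"
    using nr by (simp add: M_def N_def scalar_prod_def)
  then show False using NM nr by simp
qed

text \<open>Size 0 is always reached and \<open>n\<close> bounds all sizes, so the
  \<open>GREATEST\<close> in \<open>subrank\<close> is attained.\<close>

lemma
  shows subrank_restricts: "restricts_to n T (subrank n T) unit_tensor"
    and restricts_le_subrank: "restricts_to n T r unit_tensor \<Longrightarrow> r \<le> subrank n T"
proof -
  have e: "subrank n T = (GREATEST r. restricts_to n T r unit_tensor)"
    unfolding subrank_def restricts_to_def ..
  have 0: "restricts_to n T 0 unit_tensor"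
    by (simp add: restricts_to_iff)
  show "restricts_to n T (subrank n T) unit_tensor"
    unfolding e
    by (rule GreatestI_nat[of "\<lambda>r. restricts_to n T r unit_tensor", OF 0])
      (rule restricts_to_unit_le)
  show "restricts_to n T r unit_tensor \<Longrightarrow> r \<le> subrank n T"
    unfolding e
    by (rule Greatest_le_nat[of "\<lambda>r. restricts_to n T r unit_tensor"])
      (auto intro: restricts_to_unit_le)
qed

lemma subrank_le: "subrank n T \<le> n"
  by (rule restricts_to_unit_le[OF subrank_restricts])

lemma subrank_mono:
  assumes "restricts_to n T p S"
  shows "subrank p S \<le> subrank n T"
  by (intro restricts_le_subrank restricts_to_trans[OF assms] subrank_restricts)

section \<open>Supermultiplicativity and positivity of the subrank\<close>

lemma unit_tensor_kronecker:
  "kronecker n unit_tensor unit_tensor = unit_tensor"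
proof -
  have "(i div n = j div n \<and> i mod n = j mod n) = (i = j)" for i j
    by (metis div_mult_mod_eq)
  then show ?thesis
    by (fastforce simp: kronecker_def unit_tensor_def fun_eq_iff)
qed

lemma subrank_kronecker:
  "subrank n S * subrank m T \<le> subrank (n * m) (kronecker m S T)"
  by (rule restricts_le_subrank)
    (metis restricts_to_kronecker subrank_restricts unit_tensor_kronecker)

lemma subrank_kronecker_power_add:
  "subrank (n ^ m) (kronecker_power n T m) * subrank (n ^ k) (kronecker_power n T k)
     \<le> subrank (n ^ (m + k)) (kronecker_power n T (m + k))"
  unfolding kronecker_power_add power_add by (rule subrank_kronecker)

lemma subrank_pos:
  assumes "T i j k \<noteq> 0" "i < n" "j < n" "k < n"
  shows "0 < subrank n T"
proof -
  have "restricts_to n T 1 unit_tensor"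
    by (rule restricts_to_coordinates[of _ "\<lambda>_. i" _ "\<lambda>_. j" "\<lambda>_. k" _ "\<lambda>_. inverse (T i j k)"])
      (use assms in \<open>auto simp: unit_tensor_def\<close>)
  from restricts_le_subrank[OF this] show ?thesis by simp
qed

section \<open>Tensors that degenerate to a diagonal\<close>

text \<open>A combinatorial degeneration to the diagonal: scaling coordinates by powers of
  \<open>t\<close> with these exponents leaves exactly the diagonal at \<open>t = 0\<close>. The
  bound \<open>K\<close> is put on \<alpha> and \<beta> because these two label the weight
  classes.\<close>

definition weighted_diagonal ::
  "nat \<Rightarrow> 'a::field tensor3 \<Rightarrow> (nat \<Rightarrow> int) \<Rightarrow> (nat \<Rightarrow> int) \<Rightarrow> (nat \<Rightarrow> int) \<Rightarrow> nat \<Rightarrow> bool" where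
  "weighted_diagonal n T \<alpha> \<beta> \<gamma> K \<longleftrightarrow>
     (\<forall>i<n. T i i i \<noteq> 0 \<and> \<alpha> i + \<beta> i + \<gamma> i = 0 \<and> \<bar>\<alpha> i\<bar> \<le> int K \<and> \<bar>\<beta> i\<bar> \<le> int K) \<and>
     (\<forall>i<n. \<forall>j<n. \<forall>k<n. T i j k \<noteq> 0 \<longrightarrow>
        0 \<le> \<alpha> i + \<beta> j + \<gamma> k \<and> (\<alpha> i + \<beta> j + \<gamma> k = 0 \<longrightarrow> i = j \<and> j = k))"

text \<open>Weights add over the two digits. A sum of two nonnegative weights vanishes only if both
  do, and then both digits agree in all three directions.\<close>

lemma weighted_diagonal_kronecker:
  assumes "weighted_diagonal n S \<alpha> \<beta> \<gamma> K" "weighted_diagonal m T \<alpha>' \<beta>' \<gamma>' K'"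
  defines "w \<equiv> \<lambda>a a' i. a (i div m) + a' (i mod m)"
  shows "weighted_diagonal (n * m) (kronecker m S T) (w \<alpha> \<alpha>') (w \<beta> \<beta>') (w \<gamma> \<gamma>') (K + K')"
proof -
  have dm: "i div m < n \<and> i mod m < m" if "i < n * m" for i
  proof -
    have "m > 0" using that by (cases m) auto
    then show ?thesis using that by (simp add: less_mult_imp_div_less)
  qed
  have 1: "kronecker m S T i i i \<noteq> 0 \<and> w \<alpha> \<alpha>' i + w \<beta> \<beta>' i + w \<gamma> \<gamma>' i = 0 \<and>
      \<bar>w \<alpha> \<alpha>' i\<bar> \<le> int (K + K') \<and> \<bar>w \<beta> \<beta>' i\<bar> \<le> int (K + K')" if "i < n * m" for i
  proof -
    have "S (i div m) (i div m) (i div m) \<noteq> 0 \<and> \<alpha> (i div m) + \<beta> (i div m) + \<gamma> (i div m) = 0 \<and>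
        \<bar>\<alpha> (i div m)\<bar> \<le> int K \<and> \<bar>\<beta> (i div m)\<bar> \<le> int K"
      using assms(1) dm[OF that] by (auto simp: weighted_diagonal_def)
    moreover have "T (i mod m) (i mod m) (i mod m) \<noteq> 0 \<and>
        \<alpha>' (i mod m) + \<beta>' (i mod m) + \<gamma>' (i mod m) = 0 \<and>
        \<bar>\<alpha>' (i mod m)\<bar> \<le> int K' \<and> \<bar>\<beta>' (i mod m)\<bar> \<le> int K'"
      using assms(2) dm[OF that] by (auto simp: weighted_diagonal_def)
    ultimately show ?thesis by (auto simp: w_def kronecker_def)
  qed
  have 2: "0 \<le> w \<alpha> \<alpha>' i + w \<beta> \<beta>' j + w \<gamma> \<gamma>' k \<and>
      (w \<alpha> \<alpha>' i + w \<beta> \<beta>' j + w \<gamma> \<gamma>' k = 0 \<longrightarrow> i = j \<and> j = k)"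
    if l: "i < n * m" "j < n * m" "k < n * m" and nz: "kronecker m S T i j k \<noteq> 0" for i j k
  proof -
    let ?s = "\<alpha> (i div m) + \<beta> (j div m) + \<gamma> (k div m)"
    let ?t = "\<alpha>' (i mod m) + \<beta>' (j mod m) + \<gamma>' (k mod m)"
    have s: "0 \<le> ?s \<and> (?s = 0 \<longrightarrow> i div m = j div m \<and> j div m = k div m)"
      using assms(1) dm[OF l(1)] dm[OF l(2)] dm[OF l(3)] nz
      unfolding weighted_diagonal_def kronecker_def by (metis mult_zero_left)
    have t: "0 \<le> ?t \<and> (?t = 0 \<longrightarrow> i mod m = j mod m \<and> j mod m = k mod m)"
      using assms(2) dm[OF l(1)] dm[OF l(2)] dm[OF l(3)] nz
      unfolding weighted_diagonal_def kronecker_def by (metis mult_zero_right)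
    have e: "w \<alpha> \<alpha>' i + w \<beta> \<beta>' j + w \<gamma> \<gamma>' k = ?s + ?t" by (simp add: w_def)
    show ?thesis
    proof (intro conjI impI)
      show "0 \<le> w \<alpha> \<alpha>' i + w \<beta> \<beta>' j + w \<gamma> \<gamma>' k" using s t e by linarith
      assume "w \<alpha> \<alpha>' i + w \<beta> \<beta>' j + w \<gamma> \<gamma>' k = 0"
      then have "?s = 0" "?t = 0" using s t e by linarith+
      then show "i = j" "j = k" using s t by (metis div_mult_mod_eq)+
    qed
  qed
  show ?thesis unfolding weighted_diagonal_def using 1 2 by blast
qed

text \<open>The weight bound grows linearly in \<open>m\<close> while the format grows
  exponentially; this keeps the number of weight classes polynomial.\<close>

lemma weighted_diagonal_kronecker_power:
  assumes "weighted_diagonal n T \<alpha> \<beta> \<gamma> K"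
  shows "\<exists>\<alpha>' \<beta>' \<gamma>'. weighted_diagonal (n ^ m) (kronecker_power n T m) \<alpha>' \<beta>' \<gamma>' (m * K)"
proof (induction m)
  case 0
  have "weighted_diagonal 1 (\<lambda>i j k. 1::'a) (\<lambda>_. 0) (\<lambda>_. 0) (\<lambda>_. 0) 0"
    by (simp add: weighted_diagonal_def)
  then show ?case by auto
next
  case (Suc m)
  then obtain \<alpha>' \<beta>' \<gamma>' where
    "weighted_diagonal (n ^ m) (kronecker_power n T m) \<alpha>' \<beta>' \<gamma>' (m * K)" by blast
  from weighted_diagonal_kronecker[OF this assms] show ?case
    by (auto simp: mult.commute add.commute)
qed

text \<open>Pigeonhole: the diagonal splits into at most \<open>(2 * K + 1) ^ 2\<close> classes of
  equal (\<alpha>, \<beta>), and each class yields a unit tensor of its size.\<close>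

lemma weighted_diagonal_subrank:
  assumes "weighted_diagonal n T \<alpha> \<beta> \<gamma> K"
  shows "n \<le> subrank n T * (2 * K + 1) ^ 2"
proof -
  define I where "I = {- int K..int K}"
  define F where "F p = {i. i < n \<and> (\<alpha> i, \<beta> i) = p}" for p
  have diag: "T i i i \<noteq> 0" "\<alpha> i + \<beta> i + \<gamma> i = 0" "\<alpha> i \<in> I" "\<beta> i \<in> I" if "i < n" for i
    using assms that by (auto simp: weighted_diagonal_def I_def abs_le_iff)
  have fin: "finite (F p)" for p by (simp add: F_def)
  have class_bound: "card (F p) \<le> subrank n T" for p
  proof (rule restricts_le_subrank)
    obtain h where h: "bij_betw h {..<card (F p)} (F p)"
      using ex_bij_betw_nat_finite[OF fin, of p] by (auto simp: lessThan_atLeast0)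
    have hF: "h a \<in> F p" if "a < card (F p)" for a
      using h that by (auto dest: bij_betwE)
    have hn: "h a < n" if "a < card (F p)" for a
      using hF[OF that] by (simp add: F_def)
    show "restricts_to n T (card (F p)) unit_tensor"
    proof (rule restricts_to_coordinates[where u = "\<lambda>c. inverse (T (h c) (h c) (h c))"])
      fix a b c assume l: "a < card (F p)" "b < card (F p)" "c < card (F p)"
      show "unit_tensor a b c = inverse (T (h c) (h c) (h c)) * T (h a) (h b) (h c)"
      proof (cases "a = b \<and> b = c")
        case True
        then show ?thesis using diag(1)[OF hn[OF l(1)]] by (simp add: unit_tensor_def)
      next
        case False
        \<comment> \<open>Within a class the weight of any triple equals that of the diagonal
          position \<open>h c\<close>, hence is 0, and weight 0 off the diagonal forces a zero
          entry.\<close>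
        have "\<alpha> (h a) = \<alpha> (h c)" "\<beta> (h b) = \<beta> (h c)"
          using hF[OF l(1)] hF[OF l(2)] hF[OF l(3)] by (auto simp: F_def)
        then have "\<alpha> (h a) + \<beta> (h b) + \<gamma> (h c) = 0"
          using diag(2)[OF hn[OF l(3)]] by simp
        moreover have "\<not> (h a = h b \<and> h b = h c)"
          using False h l by (auto simp: bij_betw_def inj_on_def)
        ultimately have "T (h a) (h b) (h c) = 0"
          using assms hn l unfolding weighted_diagonal_def by blast
        then show ?thesis using False by (auto simp: unit_tensor_def)
      qed
    qed (rule hn, assumption)+
  qed
  have "n = card {..<n}" by simp
  also have "{..<n} = (\<Union>p\<in>I \<times> I. F p)"
    using diag(3,4) by (auto simp: F_def)
  also have "card \<dots> \<le> (\<Sum>p\<in>I \<times> I. card (F p))"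
    by (rule card_UN_le) (simp add: I_def)
  also have "\<dots> \<le> (\<Sum>p\<in>I \<times> I. subrank n T)"
    by (rule sum_mono) (rule class_bound)
  also have "\<dots> = subrank n T * (2 * K + 1) ^ 2"
  proof -
    have "card I = 2 * K + 1" by (simp add: I_def)
    then show ?thesis by (simp add: card_cartesian_product power2_eq_square)
  qed
  finally show ?thesis .
qed

section \<open>Pivots\<close>

text \<open>Justifies the \<open>THE\<close> in \<open>pivot\<close>: well-foundedness of the
  lexicographic order gives a minimal element, totality makes it least, asymmetry makes it
  unique.\<close>

lemma pivot_props:
  assumes "A \<in> carrier_mat n m" "A \<noteq> 0\<^sub>m n m"
  shows "pivot A \<in> nonzero_entries A"
    and "q \<in> nonzero_entries A \<Longrightarrow> q \<noteq> pivot A \<Longrightarrow> (pivot A, q) \<in> less_than <*lex*> less_than"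
proof -
  let ?R = "less_than <*lex*> less_than"
  let ?P = "\<lambda>p. p \<in> nonzero_entries A \<and> (\<forall>q \<in> nonzero_entries A. q \<noteq> p \<longrightarrow> (p, q) \<in> ?R)"
  have "\<exists>i<n. \<exists>j<m. A $$ (i, j) \<noteq> 0"
    using assms by (metis carrier_matD eq_matI index_zero_mat)
  then obtain x where "x \<in> nonzero_entries A"
    using assms(1) by (auto simp: nonzero_entries_def)
  moreover have "wf ?R" by auto
  ultimately obtain p where p: "p \<in> nonzero_entries A"
    "\<And>y. (y, p) \<in> ?R \<Longrightarrow> y \<notin> nonzero_entries A"
    by (metis wfE_min)
  have tot: "q = r \<or> (q, r) \<in> ?R \<or> (r, q) \<in> ?R" for q r
    by (cases q; cases r) auto
  have asym: "\<not> ((q, r) \<in> ?R \<and> (r, q) \<in> ?R)" for q r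
    by (cases q; cases r) auto
  have lt: "(p, q) \<in> ?R" if "q \<in> nonzero_entries A" "q \<noteq> p" for q
    using p(2)[of q] tot[of p q] that by metis
  then have "?P p" using p(1) by metis
  moreover have "q = p" if "?P q" for q
  proof (rule ccontr)
    assume "q \<noteq> p"
    then have "(q, p) \<in> ?R" using that p(1) by metis
    moreover have "(p, q) \<in> ?R" using lt that \<open>q \<noteq> p\<close> by metis
    ultimately show False using asym by metis
  qed
  ultimately have piv: "pivot A = p"
    unfolding pivot_def by (rule the_equality[of ?P p])
  show "pivot A \<in> nonzero_entries A"
    unfolding piv by (rule p(1))
  show "(pivot A, q) \<in> ?R" if "q \<in> nonzero_entries A" "q \<noteq> pivot A"
    using that unfolding piv by (rule lt)
qed

lemma lex_imp_weight_less:
  fixes a b c d n :: nat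
  assumes "((a, b), (c, d)) \<in> less_than <*lex*> less_than" "b < n"
  shows "n * a + b < n * c + d"
proof (cases "a < c")
  case True
  then have "n * Suc a \<le> n * c" by (intro mult_le_mono) auto
  then show ?thesis using assms(2) by simp
next
  case False
  then show ?thesis using assms(1) by auto
qed

text \<open>Replaces the lexicographic order by the weight \<open>n * i + j\<close>, a sum of a row
  term and a column term, as degeneration by coordinate scaling demands. The pivot is its unique
  minimiser on the support.\<close>

lemma pivot_weight:
  assumes "A \<in> carrier_mat n n" "A \<noteq> 0\<^sub>m n n" "pivot A = (f, g)"
  shows "f < n" "g < n" "A $$ (f, g) \<noteq> 0"
    and "\<lbrakk>i < n; j < n; A $$ (i, j) \<noteq> 0\<rbrakk> \<Longrightarrow>
      n * f + g \<le> n * i + j \<and> (n * f + g = n * i + j \<longrightarrow> i = f \<and> j = g)"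
proof -
  note p = pivot_props[OF assms(1,2), unfolded assms(3)]
  show fg: "f < n" "g < n" "A $$ (f, g) \<noteq> 0"
    using p(1) assms(1) by (auto simp: nonzero_entries_def)
  assume "i < n" "j < n" "A $$ (i, j) \<noteq> 0"
  then have "(i, j) \<in> nonzero_entries A" using assms(1) by (auto simp: nonzero_entries_def)
  from p(2)[OF this] have "(i, j) = (f, g) \<or> n * f + g < n * i + j"
    using lex_imp_weight_less[of f g i j n] fg by blast
  then show "n * f + g \<le> n * i + j \<and> (n * f + g = n * i + j \<longrightarrow> i = f \<and> j = g)"
    by auto
qed

section \<open>From matched pivots to a weighted diagonal\<close>

lemma isomorphic_imp_restricts:
  "isomorphic_tensors n T S \<Longrightarrow> restricts_to n T n S"
  unfolding isomorphic_tensors_def restricts_to_def tensor_eq_def by metis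

lemma pivot_matched_imp_weighted_diagonal:
  assumes "pivot_matched n T"
  shows "\<exists>R \<alpha> \<beta> \<gamma>. restricts_to (n * n) (kronecker n T T) n R \<and>
    weighted_diagonal n R \<alpha> \<beta> \<gamma> (n * n)"
proof -
  obtain TA TB where iso: "isomorphic_tensors n T TA" "isomorphic_tensors n T TB"
    and nz: "\<And>l. l < n \<Longrightarrow> slice1 n TA l \<noteq> 0\<^sub>m n n" "\<And>l. l < n \<Longrightarrow> slice3 n TB l \<noteq> 0\<^sub>m n n"
    and inj: "inj_on (\<lambda>l. pivot (slice1 n TA l)) {..<n}" "inj_on (\<lambda>l. pivot (slice3 n TB l)) {..<n}"
    and fst: "\<And>l. l < n \<Longrightarrow> fst (pivot (slice1 n TA l)) = fst (pivot (slice3 n TB l))"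
    using assms unfolding pivot_matched_def by metis
  define f where "f l = fst (pivot (slice1 n TA l))" for l
  define g where "g l = snd (pivot (slice1 n TA l))" for l
  define h where "h l = snd (pivot (slice3 n TB l))" for l
  have pA: "pivot (slice1 n TA l) = (f l, g l)" for l by (simp add: f_def g_def)
  have pB: "pivot (slice3 n TB l) = (f l, h l)" if "l < n" for l
    using fst[OF that] by (simp add: f_def h_def)
  have cA: "slice1 n TA l \<in> carrier_mat n n" and cB: "slice3 n TB l \<in> carrier_mat n n" for l
    by (auto simp: slice1_def slice3_def)
  note A = pivot_weight[OF cA nz(1) pA] and B = pivot_weight[OF cB nz(2) pB]
  have less: "f l < n" "g l < n" "h l < n" if "l < n" for l
    using that A(1,2) B(2) by auto
  have A0: "TA l (f l) (g l) \<noteq> 0" if "l < n" for l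
    using A(3)[OF that] that less by (simp add: slice1_def)
  have B0: "TB (f l) (h l) l \<noteq> 0" if "l < n" for l
    using B(3)[OF that that] that less by (simp add: slice3_def)
  have A1: "n * f l + g l \<le> n * j + k \<and> (n * f l + g l = n * j + k \<longrightarrow> j = f l \<and> k = g l)"
    if "l < n" "j < n" "k < n" "TA l j k \<noteq> 0" for l j k
    using A(4)[of l j k] that by (simp add: slice1_def)
  have B1: "n * f l + h l \<le> n * i + j \<and> (n * f l + h l = n * i + j \<longrightarrow> i = f l \<and> j = h l)"
    if "l < n" "i < n" "j < n" "TB i j l \<noteq> 0" for l i j
    using B(4)[of l i j] that by (simp add: slice3_def)
  have eqA: "x = y" if "x < n" "y < n" "f x = f y" "g x = g y" for x y
    using inj_onD[OF inj(1), of x y] that by (simp add: pA)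
  have eqB: "x = y" if "x < n" "y < n" "f x = f y" "h x = h y" for x y
    using inj_onD[OF inj(2), of x y] that by (simp add: pB)
  \<comment> \<open>The restriction of \<open>kronecker n TA TB\<close> to the index pairs
    \<open>(x, f x)\<close>, \<open>(f y, h y)\<close> and \<open>(g z, z)\<close>.\<close>
  define R where "R x y z = TA x (f y) (g z) * TB (f x) (h y) z" for x y z
  have lt: "a * n + b < n * n" if "a < n" "b < n" for a b
  proof -
    have "Suc a * n \<le> n * n" using that by (intro mult_le_mono) auto
    then show ?thesis using that by simp
  qed
  have "restricts_to (n * n) (kronecker n TA TB) n R"
  proof (rule restricts_to_coordinates)
    fix a b c assume "a < n" "b < n" "c < n"
    then show "R a b c = (\<lambda>_. 1) c *
        kronecker n TA TB (a * n + f a) (f b * n + h b) (g c * n + c)"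
      using less by (simp add: R_def kronecker_def)
  qed (use less lt in auto)
  then have "restricts_to (n * n) (kronecker n T T) n R"
    by (rule restricts_to_trans[OF restricts_to_kronecker[OF iso[THEN isomorphic_imp_restricts]]])
  \<comment> \<open>The total weight is the excess of \<open>(f y, g z)\<close> over the pivot of
    slice \<open>x\<close> of \<open>TA\<close> plus the excess of \<open>(f x, h y)\<close> over
    the pivot of slice \<open>z\<close> of \<open>TB\<close>. Since both pivot maps share
    \<open>f\<close>, the terms \<open>n * f x\<close> cancel; the rest is sorted by
    variable.\<close>
  moreover have "weighted_diagonal n R (\<lambda>x. - int (g x)) (\<lambda>y. int (n * f y + h y))
      (\<lambda>z. int (g z) - int (n * f z + h z)) (n * n)"
    unfolding weighted_diagonal_def
  proof (intro conjI allI impI)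
    fix x assume x: "x < n"
    show "R x x x \<noteq> 0" using A0[OF x] B0[OF x] by (simp add: R_def)
    show "- int (g x) + int (n * f x + h x) + (int (g x) - int (n * f x + h x)) = 0" by simp
    have "g x \<le> n * n" "n * f x + h x \<le> n * n"
      using lt[of "f x" "h x"] lt[of 0 "g x"] less[OF x] x by (auto simp: mult.commute)
    then show "\<bar>- int (g x)\<bar> \<le> int (n * n)" "\<bar>int (n * f x + h x)\<bar> \<le> int (n * n)"
      by linarith+
  next
    fix x y z assume l: "x < n" "y < n" "z < n" and "R x y z \<noteq> 0"
    then have nA: "TA x (f y) (g z) \<noteq> 0" and nB: "TB (f x) (h y) z \<noteq> 0"
      by (auto simp: R_def)
    note a = A1[OF l(1) less(1)[OF l(2)] less(2)[OF l(3)] nA]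
    note b = B1[OF l(3) less(1)[OF l(1)] less(3)[OF l(2)] nB]
    have w: "- int (g x) + int (n * f y + h y) + (int (g z) - int (n * f z + h z)) =
        (int (n * f y + g z) - int (n * f x + g x)) + (int (n * f x + h y) - int (n * f z + h z))"
      by simp
    show "0 \<le> - int (g x) + int (n * f y + h y) + (int (g z) - int (n * f z + h z))"
      unfolding w using a b by linarith
    assume "- int (g x) + int (n * f y + h y) + (int (g z) - int (n * f z + h z)) = 0"
    then have "n * f x + g x = n * f y + g z" "n * f z + h z = n * f x + h y"
      unfolding w using a b by linarith+
    \<comment> \<open>Both excesses vanish, so both positions are pivots. Injectivity of the first
      pivot map then identifies \<open>x\<close> with \<open>z\<close>, that of the second
      \<open>y\<close> with \<open>z\<close>.\<close>
    then have e: "f y = f x" "g z = g x" "f x = f z" "h y = h z" using a b by auto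
    show "x = y" "y = z" using eqA[of x z] eqB[of y z] e l by auto
  qed
  ultimately show ?thesis by blast
qed

section \<open>The limit\<close>

text \<open>The limit is the supremum of the quotients. Dividing \<open>m\<close> by a fixed
  \<open>k\<close> with remainder brings \<open>b m / m\<close> up to \<open>b k / k\<close> with an
  error of at most \<open>b k / m\<close>.\<close>

lemma fekete_superadditive:
  fixes b :: "nat \<Rightarrow> real"
  assumes sup: "\<And>m k. b m + b k \<le> b (m + k)" and nonneg: "\<And>m. 0 \<le> b m"
    and bound: "\<And>m. b m \<le> real m * C"
  shows "\<exists>L. (\<lambda>m. b m / real m) \<longlonglongrightarrow> L"
proof -
  define L where "L = (SUP m\<in>{1..}. b m / real m)"
  have bdd: "bdd_above ((\<lambda>m. b m / real m) ` {1..})"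
    using bound by (auto simp: bdd_above_def divide_le_eq mult.commute intro!: exI[of _ C])
  have upper: "b m / real m \<le> L" if "m \<ge> 1" for m
    unfolding L_def by (rule cSUP_upper) (use bdd that in auto)
  have multiple: "real q * b k \<le> b (q * k)" for q k
  proof (induction q)
    case (Suc q)
    then show ?case using sup[of k "q * k"] by (simp add: algebra_simps)
  qed (simp add: nonneg)
  have lower: "b k / real k - b k / real m \<le> b m / real m" if "k \<ge> 1" "m \<ge> 1" for k m
  proof -
    have "real m < real (Suc (m div k) * k)"
      using that dividend_less_div_times[of k m] by (simp only: of_nat_less_iff) (simp add: add.commute)
    then have "real m / real k - 1 \<le> real (m div k)"
      using that by (simp add: field_simps)
    then have "(real m / real k - 1) * b k \<le> real (m div k) * b k"
      by (rule mult_right_mono) (rule nonneg)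
    also have "\<dots> \<le> b (m div k * k)" by (rule multiple)
    also have "\<dots> \<le> b (m div k * k) + b (m mod k)" using nonneg by simp
    also have "\<dots> \<le> b m" using sup[of "m div k * k" "m mod k"] by simp
    finally have "(real m / real k - 1) * b k / real m \<le> b m / real m"
      by (simp add: divide_right_mono)
    moreover have "(real m / real k - 1) * b k / real m = b k / real k - b k / real m"
      using that by (simp add: field_simps)
    ultimately show ?thesis by simp
  qed
  have "(\<lambda>m. b m / real m) \<longlonglongrightarrow> L"
  proof (rule order_tendstoI)
    fix a assume "a < L"
    then obtain k where k: "k \<ge> 1" "a < b k / real k"
      unfolding L_def using less_cSUP_iff[OF _ bdd] by auto
    have "(\<lambda>m. b k / real k - b k / real m) \<longlonglongrightarrow> b k / real k - 0"
      by (intro tendsto_intros lim_const_over_n)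
    then have "\<forall>\<^sub>F m in sequentially. a < b k / real k - b k / real m"
      using k(2) by (auto intro: order_tendstoD)
    then show "\<forall>\<^sub>F m in sequentially. a < b m / real m"
      using eventually_ge_at_top[of 1]
      by eventually_elim (use lower[OF k(1)] in fastforce)
  next
    fix a assume "L < a"
    with upper show "\<forall>\<^sub>F m in sequentially. b m / real m < a"
      by (intro eventually_mono[OF eventually_ge_at_top[of 1]]) force
  qed
  then show ?thesis ..
qed

text \<open>The pigeonhole loss is polynomial in \<open>m\<close>, so it disappears at exponential
  scale.\<close>

lemma ln_poly_over_n_tendsto_0:
  fixes K :: nat
  shows "(\<lambda>m. ln (real (2 * (m * K) + 1)) / real m) \<longlonglongrightarrow> 0"
proof -
  let ?u = "\<lambda>m. ln (real (2 * K + 1)) / real m + ln (real m) / real m"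
  have "?u \<longlonglongrightarrow> 0 + 0"
    by (intro tendsto_add lim_const_over_n
        filterlim_compose[OF ln_x_over_x_tendsto_0 filterlim_real_sequentially])
  then have u: "?u \<longlonglongrightarrow> 0" by simp
  have le: "\<forall>\<^sub>F m in sequentially. ln (real (2 * (m * K) + 1)) / real m \<le> ?u m"
    using eventually_ge_at_top[of 1]
  proof eventually_elim
    case (elim m)
    have "2 * (m * K) + 1 \<le> (2 * K + 1) * m" using elim by (simp add: algebra_simps)
    then have "real (2 * (m * K) + 1) \<le> real (2 * K + 1) * real m"
      by (metis of_nat_le_iff of_nat_mult)
    then have "ln (real (2 * (m * K) + 1)) \<le> ln (real (2 * K + 1) * real m)"
      by (intro ln_mono) (auto intro: add_pos_nonneg)
    also have "\<dots> = ln (real (2 * K + 1)) + ln (real m)"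
      using elim by (simp add: ln_mult_pos del: of_nat_add of_nat_mult)
    finally show ?case by (simp add: add_divide_distrib[symmetric] divide_right_mono)
  qed
  show ?thesis
    by (rule tendsto_sandwich[OF _ le tendsto_const u]) (auto intro!: always_eventually)
qed

theorem theorem5p19:
  fixes n :: nat and T :: "'a::field tensor3"
  assumes "concise n T" and "pivot_matched n T"
  shows "\<exists>L::real.
    (\<lambda>m. root m (real (subrank (n ^ m) (kronecker_power n T m)))) \<longlonglongrightarrow> L \<and> L \<ge> sqrt (real n)"
proof (cases "n = 0")
  case True
  \<comment> \<open>For \<open>n = 0\<close> every power with \<open>m \<ge> 1\<close> has empty
    format; \<open>m = 0\<close> is left out because \<open>0 ^ 0 = 1\<close>.\<close>
  have "subrank (n ^ m) (kronecker_power n T m) = 0" if "m \<ge> 1" for m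
    using subrank_le[of "n ^ m" "kronecker_power n T m"] that True by (simp add: power_0_left)
  then have "\<forall>\<^sub>F m in sequentially. root m (real (subrank (n ^ m) (kronecker_power n T m))) = 0"
    by (intro eventually_mono[OF eventually_ge_at_top[of 1]]) simp
  then show ?thesis using True by (auto intro!: exI[of _ 0] tendsto_eventually)
next
  case False
  then have n: "n \<ge> 1" by simp
  define a where "a m = subrank (n ^ m) (kronecker_power n T m)" for m
  \<comment> \<open>Logarithms turn supermultiplicativity into the superadditivity that Fekete's
    argument takes.\<close>
  define b where "b m = ln (real (a m))" for m
  define K where "K = n * n"
  have sup: "a m * a k \<le> a (m + k)" for m k
    unfolding a_def by (rule subrank_kronecker_power_add)
  obtain R \<alpha> \<beta> \<gamma> where R: "restricts_to (n * n) (kronecker n T T) n R"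
    "weighted_diagonal n R \<alpha> \<beta> \<gamma> K"
    using pivot_matched_imp_weighted_diagonal[OF assms(2)] unfolding K_def by blast
  have even: "n ^ m \<le> a (2 * m) * (2 * (m * K) + 1) ^ 2" for m
  proof -
    have "n ^ m \<le> subrank (n ^ m) (kronecker_power n R m) * (2 * (m * K) + 1) ^ 2"
      using weighted_diagonal_kronecker_power[OF R(2)] weighted_diagonal_subrank by blast
    also have "subrank (n ^ m) (kronecker_power n R m)
        \<le> subrank ((n * n) ^ m) (kronecker_power (n * n) (kronecker n T T) m)"
      by (rule subrank_mono[OF restricts_to_kronecker_power[OF R(1)]])
    also have "\<dots> = a (2 * m)"
      unfolding kronecker_power_square a_def by (simp add: power_mult power2_eq_square)
    finally show ?thesis by simp
  qed
  \<comment> \<open>Needed to make every \<open>a m\<close> positive before taking logarithms: if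
    \<open>T\<close> vanished, so would its restriction \<open>R\<close>, whose diagonal is
    nonzero.\<close>
  have "\<exists>i<n. \<exists>j<n. \<exists>k<n. T i j k \<noteq> 0"
  proof (rule ccontr)
    assume "\<not> ?thesis"
    then have T0: "\<And>i j k. \<lbrakk>i < n; j < n; k < n\<rbrakk> \<Longrightarrow> T i j k = 0" by blast
    obtain A B C where "\<forall>x<n. \<forall>y<n. \<forall>z<n. R x y z = (\<Sum>i<n * n. \<Sum>j<n * n. \<Sum>k<n * n.
        A x i * B y j * C z k * kronecker n T T i j k)"
      using R(1) unfolding restricts_to_iff by blast
    moreover have "kronecker n T T i j k = 0" if "i < n * n" "j < n * n" "k < n * n" for i j k
      using T0 n that by (simp add: kronecker_def)
    ultimately have "R 0 0 0 = 0" using n by simp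
    then show False using R(2) n by (auto simp: weighted_diagonal_def)
  qed
  then obtain i j k where ijk: "i < n" "j < n" "k < n" "T i j k \<noteq> 0" by blast
  have a1: "a 1 \<ge> 1"
    using subrank_pos[of "kronecker_power n T 1" i j k n] ijk
    by (simp add: a_def kronecker_def Suc_le_eq)
  have a0: "a 0 \<ge> 1"
    using subrank_pos[of "kronecker_power n T 0" 0 0 0 1] by (simp add: a_def Suc_le_eq)
  have pos: "a m \<ge> 1" for m
  proof (induction m)
    case (Suc m)
    have "1 * 1 \<le> a m * a 1" using Suc a1 by (intro mult_le_mono)
    then show ?case using sup[of m 1] by (simp only: mult_1 add_0_right Suc_eq_plus1)
  qed (rule a0)
  have "\<exists>L. (\<lambda>m. b m / real m) \<longlonglongrightarrow> L"
  proof (rule fekete_superadditive)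
    fix m k
    have p: "real (a m) > 0" "real (a k) > 0" using pos[of m] pos[of k] by auto
    have "b m + b k = ln (real (a m) * real (a k))"
      unfolding b_def using p by (simp add: ln_mult)
    also have "\<dots> \<le> b (m + k)"
      unfolding b_def using p sup[of m k] by (intro ln_mono) (auto simp flip: of_nat_mult)
    finally show "b m + b k \<le> b (m + k)" .
    show "0 \<le> b m" unfolding b_def using pos[of m] by simp
    have "real (a m) \<le> real n ^ m"
      unfolding a_def using subrank_le by (metis of_nat_le_iff of_nat_power)
    then have "b m \<le> ln (real n ^ m)" unfolding b_def using p by (intro ln_mono) auto
    then show "b m \<le> real m * ln (real n)" using n by (simp add: ln_realpow)
  qed
  then obtain l where l: "(\<lambda>m. b m / real m) \<longlonglongrightarrow> l" by blast
  \<comment> \<open>The bound \<open>even\<close> concerns even powers only. As the limit exists, it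
    may be computed along them.\<close>
  have l_ge: "ln (real n) / 2 \<le> l"
  proof (rule LIMSEQ_le)
    have "strict_mono (\<lambda>m::nat. 2 * m)" by (simp add: strict_mono_def)
    from LIMSEQ_subseq_LIMSEQ[OF l this]
    show "(\<lambda>m. b (2 * m) / real (2 * m)) \<longlonglongrightarrow> l" by (simp add: comp_def)
    \<comment> \<open>This is the logarithm of \<open>even\<close> divided by \<open>2 * m\<close>;
      the exponent 2 of the class count cancels the 2 in the denominator.\<close>
    have "(\<lambda>m. ln (real n) / 2 - ln (real (2 * (m * K) + 1)) / real m) \<longlonglongrightarrow> ln (real n) / 2 - 0"
      by (intro tendsto_diff tendsto_const ln_poly_over_n_tendsto_0)
    then show "(\<lambda>m. ln (real n) / 2 - ln (real (2 * (m * K) + 1)) / real m) \<longlonglongrightarrow> ln (real n) / 2"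
      by simp
    show "\<exists>N. \<forall>m\<ge>N. ln (real n) / 2 - ln (real (2 * (m * K) + 1)) / real m
        \<le> b (2 * m) / real (2 * m)"
    proof (intro exI[of _ 1] allI impI)
      fix m :: nat assume m: "1 \<le> m"
      let ?P = "real (2 * (m * K) + 1)"
      have p: "real (a (2 * m)) > 0" using pos[of "2 * m"] by simp
      have "real (n ^ m) \<le> real (a (2 * m) * (2 * (m * K) + 1) ^ 2)"
        using even by (simp only: of_nat_le_iff)
      then have "real n ^ m \<le> real (a (2 * m)) * ?P ^ 2"
        by (simp only: of_nat_mult of_nat_power)
      then have "ln (real n ^ m) \<le> ln (real (a (2 * m)) * ?P ^ 2)"
        using n by (intro ln_mono) auto
      also have "\<dots> = b (2 * m) + 2 * ln ?P"
        using p by (subst ln_mult) (auto simp: b_def ln_realpow simp del: of_nat_add of_nat_mult)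
      finally have "real m * ln (real n) \<le> b (2 * m) + 2 * ln ?P"
        using n by (simp add: ln_realpow)
      then have "(real m * ln (real n) - 2 * ln ?P) / (2 * real m) \<le> b (2 * m) / (2 * real m)"
        by (intro divide_right_mono) auto
      then show "ln (real n) / 2 - ln ?P / real m \<le> b (2 * m) / real (2 * m)"
        using m by (simp add: diff_divide_distrib)
    qed
  qed
  \<comment> \<open>Only for \<open>m \<ge> 1\<close>: at \<open>m = 0\<close> the default values
    give \<open>root 0 x = 0\<close> but \<open>exp (b 0 / 0) = 1\<close>.\<close>
  have "\<forall>\<^sub>F m in sequentially. exp (b m / real m) = root m (real (a m))"
  proof (rule eventually_mono[OF eventually_ge_at_top[of 1]])
    fix m :: nat assume m: "1 \<le> m"
    have p: "real (a m) > 0" using pos[of m] by simp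
    show "exp (b m / real m) = root m (real (a m))"
      using m p by (simp add: root_powr_inverse powr_def b_def)
  qed
  then have "(\<lambda>m. root m (real (a m))) \<longlonglongrightarrow> exp l"
    using tendsto_exp[OF l] by (simp cong: tendsto_cong)
  moreover have "sqrt (real n) = exp (ln (real n) / 2)"
    using n by (simp add: powr_half_sqrt[symmetric] powr_def)
  ultimately show ?thesis
    using l_ge unfolding a_def by auto
qed

end
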